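(* For all $(x,v)\in T\mathbb{D}$ one has $(\psi^*F_+)(x,v)=F_F(x,v)$; that is, the pullback of the metric $F_+$ on the upper hemisphere by the map $\psi$ is the Funk metric on the unit disc.
   Context: $\mathbb{D}=\{x=(x_1,x_2)\in\mathbb{R}^2:|x|<1\}$, with $|\cdot|$ and $\langle\cdot,\cdot\rangle$ the Euclidean norm and inner product. The Funk metric on $\mathbb{D}$ is $F_F(x,v)=\dfrac{\sqrt{(1-|x|^2)|v|^2+\langle x,v\rangle^2}}{1-|x|^2}+\dfrac{\langle x,v\rangle}{1-|x|^2}$. On $\mathbb{R}^3_+=\{\tilde x\in\mathbb{R}^3:\tilde x_3>0\}$ let $F_+(\tilde x,\tilde v)=\dfrac{|\tilde v|}{\tilde x_3}-\dfrac{\tilde v_3}{\tilde x_3}$ for $\tilde v\in\mathbb{R}^3$. Let $\mathbb{S}^2_+=\{x\in\mathbb{R}^3:|x|=1,\ x_3>0\}$ and let $\psi:\mathbb{D}\to\mathbb{S}^2_+\subset\mathbb{R}^3_+$ be $\psi(x_1,x_2)=(x_1,x_2,\sqrt{1-|x|^2})$. The pullback is $(\psi^*F_+)(x,v)=F_+(\psi(x),D\psi_x(v))$. *)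

theory Defs
  imports "HOL-Analysis.Analysis"
begin

definition unit_disc :: "(real ^ 2) set" where
  "unit_disc = {x. norm x < 1}"

definition upper_half_space :: "(real ^ 3) set" where
  "upper_half_space = {y. y $ 3 > 0}"

definition upper_hemisphere :: "(real ^ 3) set" where
  "upper_hemisphere = {y. norm y = 1 \<and> y $ 3 > 0}"

text \<open>The metrics are total functions; \<open>F_Funk x v\<close> is meant for \<open>x\<close> in the unit disc and
  \<open>F_plus y w\<close> for \<open>y\<close> in the upper half space.\<close>

definition F_Funk :: "real ^ 2 \<Rightarrow> real ^ 2 \<Rightarrow> real" where
  "F_Funk x v =
     sqrt ((1 - (norm x)\<^sup>2) * (norm v)\<^sup>2 + (x \<bullet> v)\<^sup>2) / (1 - (norm x)\<^sup>2)
     + (x \<bullet> v) / (1 - (norm x)\<^sup>2)"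

definition F_plus :: "real ^ 3 \<Rightarrow> real ^ 3 \<Rightarrow> real" where
  "F_plus y w = norm w / y $ 3 - w $ 3 / y $ 3"

definition psi :: "real ^ 2 \<Rightarrow> real ^ 3" where
  "psi x = vector [x $ 1, x $ 2, sqrt (1 - (norm x)\<^sup>2)]"

text \<open>The differential at \<open>x\<close> is the Frechet derivative, so this is meaningful only at
  points where \<open>f\<close> is differentiable.\<close>

definition pullback ::
  "('a::real_normed_vector \<Rightarrow> 'b::real_normed_vector) \<Rightarrow> ('b \<Rightarrow> 'b \<Rightarrow> real) \<Rightarrow> 'a \<Rightarrow> 'a \<Rightarrow> real" where
  "pullback f F x v = F (f x) (frechet_derivative f (at x) v)"

lemma upper_hemisphere_subset: "upper_hemisphere \<subseteq> upper_half_space"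
  by (auto simp: upper_hemisphere_def upper_half_space_def)

lemma psi_in_upper_hemisphere:
  assumes "x \<in> unit_disc"
  shows "psi x \<in> upper_hemisphere"
proof -
  have lt: "(norm x)\<^sup>2 < 1"
    using assms by (simp add: unit_disc_def power_less_one_iff abs_square_less_1)
  have "(norm (psi x))\<^sup>2 = (x $ 1)\<^sup>2 + (x $ 2)\<^sup>2 + (1 - (norm x)\<^sup>2)"
    unfolding norm_eq_sqrt_inner[of "psi x"] using lt
    by (simp add: psi_def inner_vec_def sum_3 flip: power2_eq_square)
  also have "\<dots> = 1"
    unfolding power2_norm_eq_inner by (simp add: inner_vec_def sum_2 power2_eq_square)
  finally have "norm (psi x) = 1"
    using norm_ge_zero[of "psi x"] unfolding power2_eq_1_iff by linarith
  with lt show ?thesis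
    by (simp add: upper_hemisphere_def psi_def)
qed

lemma psi_differentiable:
  assumes "x \<in> unit_disc"
  shows "psi differentiable (at x)"
proof -
  have pos: "0 < 1 - x \<bullet> x"
    using assms
    by (simp add: unit_disc_def abs_square_less_1 flip: power2_norm_eq_inner)
  have "(\<lambda>y. psi y $ i) differentiable (at x)" for i
  proof -
    have "((\<lambda>y. y $ k) has_derivative (\<lambda>v. v $ k)) (at x)" for k :: 2
      by (intro bounded_linear_imp_has_derivative bounded_linear_vec_nth)
    moreover have "((\<lambda>y. sqrt (1 - y \<bullet> y)) has_derivative
        (\<lambda>v. (- (2 * (x \<bullet> v))) / (2 * sqrt (1 - x \<bullet> x)))) (at x)"
      using pos by (auto intro!: derivative_eq_intros simp: inner_commute field_simps)
    ultimately show ?thesis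
      using exhaust_3[of i] unfolding psi_def power2_norm_eq_inner differentiable_def
      by (elim disjE; simp; blast)
  qed
  then show ?thesis
    by (subst differentiable_componentwise_within) (auto simp: Basis_vec_def inner_axis)
qed

end

theory Submission
  imports Defs
begin

text \<open>Put r = 1 - |x|^2 > 0. The point \<open>psi x\<close> has height sqrt r, and by
  \<open>psi_has_derivative\<close> the differential sends v to w = (v, -<x,v>/sqrt r). Hence |w|^2
  = (r|v|^2 + <x,v>^2)/r, so |w| over the height is the root term of the Funk metric, and minus w_3
  over the height is its linear term.\<close>

lemma psi_has_derivative:
  assumes "x \<in> unit_disc"
  shows "(psi has_derivative
    (\<lambda>v. vector [v $ 1, v $ 2, - (x \<bullet> v) / sqrt (1 - (norm x)\<^sup>2)])) (at x)"
    (is "(psi has_derivative ?D) _")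
proof -
  have pos: "0 < 1 - x \<bullet> x"
    using assms
    by (simp add: unit_disc_def abs_square_less_1 flip: power2_norm_eq_inner)
  have "((\<lambda>y. psi y $ i) has_derivative (\<lambda>v. ?D v $ i)) (at x)" for i
  proof -
    have "((\<lambda>y. y $ k) has_derivative (\<lambda>v. v $ k)) (at x)" for k :: 2
      by (intro bounded_linear_imp_has_derivative bounded_linear_vec_nth)
    \<comment> \<open>\<open>pos\<close> keeps the radicand away from 0, where sqrt is not
      differentiable.\<close>
    moreover have "((\<lambda>y. sqrt (1 - y \<bullet> y)) has_derivative
        (\<lambda>v. - (x \<bullet> v) / sqrt (1 - x \<bullet> x))) (at x)"
      using pos by (auto intro!: derivative_eq_intros simp: inner_commute field_simps)
    ultimately show ?thesis
      using exhaust_3[of i] unfolding psi_def power2_norm_eq_inner by auto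
  qed
  then show ?thesis
    by (subst has_derivative_componentwise_within) (auto simp: Basis_vec_def inner_axis)
qed

theorem proposition3p5:
  fixes x v :: "real ^ 2"
  assumes "x \<in> unit_disc"
  shows "pullback psi F_plus x v = F_Funk x v"
proof -
  define r where "r = 1 - (norm x)\<^sup>2"
  have r: "0 < r"
    using assms by (simp add: r_def unit_disc_def abs_square_less_1)
  define w :: "real ^ 3" where "w = vector [v $ 1, v $ 2, - (x \<bullet> v) / sqrt r]"
  \<comment> \<open>\<open>frechet_derivative\<close> is a choice; uniqueness of the derivative
    identifies it with the explicit map.\<close>
  have D: "frechet_derivative psi (at x) v = w"
    using frechet_derivative_at[OF psi_has_derivative[OF assms]]
    by (simp add: w_def r_def fun_eq_iff)
  have "w \<bullet> w = v \<bullet> v + (x \<bullet> v)\<^sup>2 / r"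
    using r by (simp add: w_def inner_vec_def sum_3 sum_2 flip: power2_eq_square)
      (simp add: power_divide power2_eq_square algebra_simps)
  then have "w \<bullet> w = (r * (norm v)\<^sup>2 + (x \<bullet> v)\<^sup>2) / r"
    using r by (simp add: power2_norm_eq_inner field_simps)
  \<comment> \<open>The root of 1/r and the height each give a factor 1/sqrt r, together
    1/r.\<close>
  then have "norm w / sqrt r = sqrt (r * (norm v)\<^sup>2 + (x \<bullet> v)\<^sup>2) / r"
    using r by (simp add: norm_eq_sqrt_inner[of w] real_sqrt_divide)
  \<comment> \<open>This sign cancels against the minus in \<open>F_plus\<close>.\<close>
  moreover have "w $ 3 / sqrt r = - (x \<bullet> v) / r"
    using r by (simp add: w_def)
  moreover have "psi x $ 3 = sqrt r"
    by (simp add: psi_def r_def)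
  ultimately show ?thesis
    unfolding pullback_def F_plus_def F_Funk_def D r_def[symmetric] by simp
qed

end
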